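(* For every number of agents $n\ge 1$, the asymptotic competitive ratio of any randomized online algorithm for the online max-min fair allocation problem is at most $1/n$ in the adversarial arrival model.
   Context: Setting (online max-min fair allocation, adversarial arrival). There are agents $N=\{1,\dots,n\}$; a finite sequence $\sigma$ of items, fixed in advance by an oblivious adversary, arrives one by one. On arrival of an item $e$ its value vector $(v_1(e),\dots,v_n(e))\in[0,1]^n$ is revealed, and $e$ must be irrevocably given to one agent; the number of items is not known in advance. Valuations are additive: $v_i(X)=\sum_{e\in X}v_i(e)$. A (randomized) online algorithm's decision for an item depends only on the value vectors revealed so far (including that of the current item), on its past decisions and on its internal randomness. $\mathrm{ALG}(\sigma)$ is $\min_{i\in N}v_i(A_i)$ for the allocation $(A_1,\dots,A_n)$ produced by the algorithm, and $\mathrm{OPT}(\sigma)$ is the maximum of $\min_{i\in N}v_i(A_i)$ over all allocations (partitions of the items into $n$ parts). The asymptotic competitive ratio of $\mathrm{ALG}$ is $$\liminf_{\mathrm{OPT}(\sigma)\to\infty}\frac{\mathbb{E}[\mathrm{ALG}(\sigma)]}{\mathrm{OPT}(\sigma)}:=\lim_{K\to\infty}\ \inf_{\sigma:\,\mathrm{OPT}(\sigma)\ge K}\frac{\mathbb{E}[\mathrm{ALG}(\sigma)]}{\mathrm{OPT}(\sigma)} .$$ *)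

theory Defs
  imports "HOL-Probability.Probability"
begin

text \<open>
  Agents are \<open>1, \<dots>, n\<close>. An item is represented by its value vector; an input is the list of the
  value vectors in order of arrival. Equal value vectors may occur several times, so individual
  items are referred to by their positions in this list.
\<close>

type_synonym item = "nat \<Rightarrow> real"

definition items :: "nat \<Rightarrow> item set" where
  "items n = ({1..n} \<rightarrow>\<^sub>E {0..1})"

definition valuation :: "item list \<Rightarrow> nat \<Rightarrow> nat set \<Rightarrow> real" where
  "valuation \<sigma> i X = (\<Sum>k\<in>X. (\<sigma> ! k) i)"

definition is_allocation :: "nat \<Rightarrow> item list \<Rightarrow> (nat \<Rightarrow> nat set) \<Rightarrow> bool" where
  "is_allocation n \<sigma> A \<longleftrightarrow>
     disjoint_family_on A {1..n} \<and> (\<Union>i\<in>{1..n}. A i) = {..<length \<sigma>}"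

definition min_value :: "nat \<Rightarrow> item list \<Rightarrow> (nat \<Rightarrow> nat set) \<Rightarrow> real" where
  "min_value n \<sigma> A = Min ((\<lambda>i. valuation \<sigma> i (A i)) ` {1..n})"

definition OPT :: "nat \<Rightarrow> item list \<Rightarrow> real" where
  "OPT n \<sigma> = Max {min_value n \<sigma> A | A. is_allocation n \<sigma> A}"

text \<open>
  \<open>alg vs ds \<omega>\<close> is the agent receiving the current item, where \<open>vs\<close> lists the value vectors revealed
  so far (the last one being that of the current item), \<open>ds\<close> lists the past decisions, and \<open>\<omega>\<close> is
  the internal randomness, drawn once from an arbitrary probability space \<open>M\<close> (which may
  be a product space supplying fresh randomness for every step).
\<close>

type_synonym 'r online_alg = "item list \<Rightarrow> nat list \<Rightarrow> 'r \<Rightarrow> nat"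

definition randomized_online_algorithm :: "nat \<Rightarrow> 'r measure \<Rightarrow> 'r online_alg \<Rightarrow> bool" where
  "randomized_online_algorithm n M alg \<longleftrightarrow>
     prob_space M \<and>
     (\<forall>vs\<in>lists (items n). \<forall>ds\<in>lists {1..n}. length vs = Suc (length ds) \<longrightarrow>
        alg vs ds \<in> M \<rightarrow>\<^sub>M count_space {1..n})"

text \<open>The decisions made for the first \<open>k\<close> items of \<open>\<sigma>\<close>.\<close>

primrec decisions :: "'r online_alg \<Rightarrow> 'r \<Rightarrow> item list \<Rightarrow> nat \<Rightarrow> nat list" where
  "decisions alg \<omega> \<sigma> 0 = []"
| "decisions alg \<omega> \<sigma> (Suc k) =
     decisions alg \<omega> \<sigma> k @ [alg (take (Suc k) \<sigma>) (decisions alg \<omega> \<sigma> k) \<omega>]"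

definition online_allocation :: "'r online_alg \<Rightarrow> 'r \<Rightarrow> item list \<Rightarrow> nat \<Rightarrow> nat set" where
  "online_allocation alg \<omega> \<sigma> i =
     {k. k < length \<sigma> \<and> decisions alg \<omega> \<sigma> (length \<sigma>) ! k = i}"

definition ALG :: "nat \<Rightarrow> 'r online_alg \<Rightarrow> item list \<Rightarrow> 'r \<Rightarrow> real" where
  "ALG n alg \<sigma> \<omega> = min_value n \<sigma> (online_allocation alg \<omega> \<sigma>)"

definition inf_ratio :: "nat \<Rightarrow> 'r measure \<Rightarrow> 'r online_alg \<Rightarrow> real \<Rightarrow> ereal" where
  "inf_ratio n M alg K =
     (INF \<sigma>\<in>{\<sigma> \<in> lists (items n). OPT n \<sigma> \<ge> K}.
        ereal (prob_space.expectation M (ALG n alg \<sigma>) / OPT n \<sigma>))"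

definition asymptotic_competitive_ratio :: "nat \<Rightarrow> 'r measure \<Rightarrow> 'r online_alg \<Rightarrow> ereal" where
  "asymptotic_competitive_ratio n M alg = Lim at_top (inf_ratio n M alg)"

text \<open>The limit always exists, since the infimum is monotone in \<open>K\<close>.\<close>

lemma inf_ratio_mono: "mono (inf_ratio n M alg)"
  unfolding inf_ratio_def by (intro monoI INF_superset_mono) auto

lemma tendsto_asymptotic_competitive_ratio:
  "(inf_ratio n M alg \<longlongrightarrow> asymptotic_competitive_ratio n M alg) at_top"
proof -
  let ?s = "SUP K. inf_ratio n M alg K"
  have "(inf_ratio n M alg \<longlongrightarrow> ?s) at_top"
  proof (rule order_tendstoI)
    fix a assume "a < ?s"
    then obtain K where "a < inf_ratio n M alg K"
      by (auto simp: less_SUP_iff)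
    then have "\<forall>K'\<ge>K. a < inf_ratio n M alg K'"
      using inf_ratio_mono[of n M alg] by (meson less_le_trans monoD)
    then show "\<forall>\<^sub>F K in at_top. a < inf_ratio n M alg K"
      by (auto simp: eventually_at_top_linorder)
  next
    fix a assume "?s < a"
    then show "\<forall>\<^sub>F K in at_top. inf_ratio n M alg K < a"
      by (intro always_eventually allI) (meson SUP_upper UNIV_I le_less_trans)
  qed
  then show ?thesis
    unfolding asymptotic_competitive_ratio_def by (simp add: tendsto_Lim)
qed

end

(* The adversary first sends m items that every agent values at 1, then picks an agent i and, for
   every other agent j, sends m items that only j values. Giving the first m items to i shows that
   OPT is at least m. The online algorithm has to split the first m items before i is known: since
   the expected shares of the n agents add up to m, some agent i gets at most m/n of them in
   expectation, and the later items are worthless to i. *)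

theory Submission
  imports Defs
begin

section \<open>Online decisions, their measurability, and the maximum defining
  \<open>OPT\<close>\<close>

lemma length_decisions [simp]: "length (decisions alg \<omega> \<sigma> k) = k"
  by (induction k) auto

lemma take_decisions: "j \<le> k \<Longrightarrow> take j (decisions alg \<omega> \<sigma> k) = decisions alg \<omega> \<sigma> j"
proof (induction k)
  case (Suc k)
  then show ?case by (cases "j = Suc k") auto
qed simp

lemma decisions_take: "k \<le> m \<Longrightarrow> decisions alg \<omega> (take m \<sigma>) k = decisions alg \<omega> \<sigma> k"
  by (induction k) (auto simp: min_def)

text \<open>This is where onlineness enters: the decisions on the first \<open>m\<close> items are
  those made if the input stopped after them, so later items cannot influence them.\<close>

lemma nth_decisions_prefix:
  assumes "k < m" "m \<le> l"
  shows "decisions alg \<omega> \<sigma> l ! k = decisions alg \<omega> (take m \<sigma>) m ! k"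
  using assms by (metis decisions_take nth_take order_refl take_decisions)

text \<open>The algorithm is assumed measurable only for each fixed history, while the actual past
  is itself random. That past ranges over the finitely many lists of length \<open>k\<close> over
  the agents, so the measurable maps for the fixed histories can be glued together.\<close>

lemma measurable_decisions:
  assumes alg: "randomized_online_algorithm n M alg"
    and \<sigma>: "\<sigma> \<in> lists (items n)" and k: "k \<le> length \<sigma>"
  shows "(\<lambda>\<omega>. decisions alg \<omega> \<sigma> k)
           \<in> M \<rightarrow>\<^sub>M count_space {ds. set ds \<subseteq> {1..n} \<and> length ds = k}"
  using k
proof (induction k)
  case 0
  then show ?case by simp
next
  case (Suc k)
  let ?L = "\<lambda>k. {ds. set ds \<subseteq> {1..n} \<and> length ds = k}"
  have "(\<lambda>\<omega>. ds @ [alg (take (Suc k) \<sigma>) ds \<omega>]) \<in> M \<rightarrow>\<^sub>M count_space (?L (Suc k))"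
    if ds: "ds \<in> ?L k" for ds
  proof -
    have "take (Suc k) \<sigma> \<in> lists (items n)"
      using \<sigma> by (auto dest: in_set_takeD)
    moreover have "length (take (Suc k) \<sigma>) = Suc (length ds)" "ds \<in> lists {1..n}"
      using ds Suc.prems by auto
    ultimately have "alg (take (Suc k) \<sigma>) ds \<in> M \<rightarrow>\<^sub>M count_space {1..n}"
      using alg unfolding randomized_online_algorithm_def by blast
    moreover have "(\<lambda>i. ds @ [i]) \<in> count_space {1..n} \<rightarrow>\<^sub>M count_space (?L (Suc k))"
      using ds by auto
    ultimately show ?thesis
      by (rule measurable_compose)
  qed
  moreover have "(\<lambda>\<omega>. decisions alg \<omega> \<sigma> k) \<in> M \<rightarrow>\<^sub>M count_space (?L k)"
    using Suc by simp
  moreover have "countable (?L k)"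
    by (intro countable_finite finite_lists_length_eq) simp
  ultimately show ?case
    unfolding decisions.simps by (rule measurable_compose_countable')
qed

text \<open>An allocation is arbitrary outside \<open>{1..n}\<close>, so there are infinitely many
  of them. Restricting to the agents keeps the minimum and leaves finitely many candidates, which
  makes the \<open>Max\<close> in \<open>OPT\<close> a genuine maximum.\<close>

lemma finite_min_values: "finite {min_value n \<sigma> A | A. is_allocation n \<sigma> A}"
proof (rule finite_subset)
  show "{min_value n \<sigma> A | A. is_allocation n \<sigma> A}
          \<subseteq> min_value n \<sigma> ` ({1..n} \<rightarrow>\<^sub>E Pow {..<length \<sigma>})"
  proof safe
    fix A assume "is_allocation n \<sigma> A"
    then have "restrict A {1..n} \<in> {1..n} \<rightarrow>\<^sub>E Pow {..<length \<sigma>}"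
      unfolding is_allocation_def by fastforce
    moreover have "min_value n \<sigma> A = min_value n \<sigma> (restrict A {1..n})"
      unfolding min_value_def by (intro arg_cong[where f = Min] image_cong) auto
    ultimately show "min_value n \<sigma> A \<in> min_value n \<sigma> ` ({1..n} \<rightarrow>\<^sub>E Pow {..<length \<sigma>})"
      by blast
  qed
qed (intro finite_imageI finite_PiE; simp)

lemma min_value_le_OPT: "is_allocation n \<sigma> A \<Longrightarrow> min_value n \<sigma> A \<le> OPT n \<sigma>"
  unfolding OPT_def by (intro Max_ge finite_min_values) auto

section \<open>Expected shares and averaging\<close>

definition share :: "'r online_alg \<Rightarrow> item list \<Rightarrow> nat \<Rightarrow> 'r \<Rightarrow> real" where
  "share alg \<sigma> i \<omega> = real (card {k. k < length \<sigma> \<and> decisions alg \<omega> \<sigma> (length \<sigma>) ! k = i})"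

lemma integrable_share:
  assumes "randomized_online_algorithm n M alg" "\<sigma> \<in> lists (items n)"
  shows "integrable M (share alg \<sigma> i)"
proof -
  interpret prob_space M
    using assms(1) by (simp add: randomized_online_algorithm_def)
  have "card {k. k < length \<sigma> \<and> decisions alg \<omega> \<sigma> (length \<sigma>) ! k = i}
          \<le> card {..<length \<sigma>}" for \<omega>
    by (rule card_mono) auto
  then have "norm (share alg \<sigma> i \<omega>) \<le> real (length \<sigma>)" for \<omega>
    by (simp add: share_def)
  moreover have "share alg \<sigma> i \<in> borel_measurable M"
    unfolding share_def
    by (rule measurable_compose[OF measurable_decisions[OF assms order_refl]])
      (simp add: measurable_count_space_eq1)
  ultimately show ?thesis
    by (intro integrable_const_bound[where B = "real (length \<sigma>)"] AE_I2)
qed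

lemma sum_share:
  assumes "randomized_online_algorithm n M alg" "\<sigma> \<in> lists (items n)" "\<omega> \<in> space M"
  shows "(\<Sum>i\<in>{1..n}. share alg \<sigma> i \<omega>) = real (length \<sigma>)"
proof -
  let ?d = "\<lambda>k. decisions alg \<omega> \<sigma> (length \<sigma>) ! k"
  \<comment> \<open>On \<open>space M\<close> every decision is a real agent, so each item is
    counted in exactly one share.\<close>
  have "set (decisions alg \<omega> \<sigma> (length \<sigma>)) \<subseteq> {1..n}"
    using measurable_space[OF measurable_decisions[OF assms(1,2) order_refl] assms(3)] by simp
  then have "?d k \<in> {1..n}" if "k < length \<sigma>" for k
    using that nth_mem[of k "decisions alg \<omega> \<sigma> (length \<sigma>)"]
    by (simp only: length_decisions subset_iff)
  then have "{..<length \<sigma>} = (\<Union>i\<in>{1..n}. {k. k < length \<sigma> \<and> ?d k = i})"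
    by auto
  then have "length \<sigma> = card (\<Union>i\<in>{1..n}. {k. k < length \<sigma> \<and> ?d k = i})"
    by (metis card_lessThan)
  also have "\<dots> = (\<Sum>i\<in>{1..n}. card {k. k < length \<sigma> \<and> ?d k = i})"
    by (intro card_UN_disjoint) auto
  finally show ?thesis
    by (simp add: share_def flip: of_nat_sum)
qed

lemma exists_small_expected_share:
  assumes "n \<ge> 1" "randomized_online_algorithm n M alg" "\<sigma> \<in> lists (items n)"
  shows "\<exists>i\<in>{1..n}. integral\<^sup>L M (share alg \<sigma> i) \<le> real (length \<sigma>) / real n"
proof -
  interpret prob_space M
    using assms(2) by (simp add: randomized_online_algorithm_def)
  have "(\<Sum>i\<in>{1..n}. expectation (share alg \<sigma> i))
      = expectation (\<lambda>\<omega>. \<Sum>i\<in>{1..n}. share alg \<sigma> i \<omega>)"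
    using integrable_share[OF assms(2,3)] by (intro Bochner_Integration.integral_sum[symmetric])
  also have "\<dots> = expectation (\<lambda>\<omega>. real (length \<sigma>))"
    using sum_share[OF assms(2,3)] by (intro Bochner_Integration.integral_cong) auto
  also have "\<dots> = (\<Sum>i\<in>{1..n}. real (length \<sigma>) / real n)"
    using assms(1) by (simp add: prob_space)
  finally have eq: "(\<Sum>i\<in>{1..n}. expectation (share alg \<sigma> i))
      = (\<Sum>i\<in>{1..n}. real (length \<sigma>) / real n)" .
  show ?thesis
  proof (rule ccontr)
    assume "\<not> ?thesis"
    then have "real (length \<sigma>) / real n < expectation (share alg \<sigma> i)" if "i \<in> {1..n}" for i
      using that by (meson not_le)
    then have "(\<Sum>i\<in>{1..n}. real (length \<sigma>) / real n)
        < (\<Sum>i\<in>{1..n}. expectation (share alg \<sigma> i))"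
      using assms(1) by (intro sum_strict_mono) auto
    with eq show False
      by simp
  qed
qed

section \<open>The hard inputs and their optimum\<close>

definition common_items :: "nat \<Rightarrow> nat \<Rightarrow> item list" where
  "common_items n m = replicate m (\<lambda>l\<in>{1..n}. 1)"

text \<open>Block \<open>0\<close> of length \<open>m\<close> consists of the common items; for \<open>1 \<le> j \<le> n\<close>, block \<open>j\<close> is valued by
  agent \<open>j\<close> only, and it is worthless to everyone if \<open>j = i\<close>.\<close>

definition hard_input :: "nat \<Rightarrow> nat \<Rightarrow> nat \<Rightarrow> item list" where
  "hard_input n m i =
     map (\<lambda>k. \<lambda>l\<in>{1..n}. if k < m \<or> k div m = l \<and> l \<noteq> i then 1 else 0) [0..<m * Suc n]"

lemma common_items_in_lists: "common_items n m \<in> lists (items n)"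
  by (auto simp: common_items_def items_def)

lemma hard_input_in_lists: "hard_input n m i \<in> lists (items n)"
  by (auto simp: hard_input_def items_def)

text \<open>The first \<open>m\<close> items carry no trace of \<open>i\<close>, so the adversary
  may fix \<open>i\<close> after inspecting the expected shares of the common items.\<close>

lemma take_hard_input: "take m (hard_input n m i) = common_items n m"
  by (rule nth_equalityI) (auto simp: hard_input_def common_items_def)

lemma length_hard_input: "length (hard_input n m i) = m * Suc n"
  by (simp add: hard_input_def)

lemma nth_hard_input:
  assumes "k < m * Suc n" "l \<in> {1..n}"
  shows "(hard_input n m i ! k) l = (if k < m \<or> k div m = l \<and> l \<noteq> i then 1 else 0)"
  using assms by (simp add: hard_input_def del: upt_Suc mult_Suc_right)

lemma card_block:
  assumes "(m::nat) > 0"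
  shows "card {k. k div m = j} = m"
proof -
  have "{k. k div m = j} = {j * m..<j * m + m}"
    using assms dividend_less_div_times[of m]
    by (auto simp: add.commute mult.commute intro!: div_nat_eqI)
  then show ?thesis by simp
qed

lemma OPT_hard_input:
  assumes "m > 0" "i \<in> {1..n}"
  shows "real m \<le> OPT n (hard_input n m i)"
proof -
  let ?\<sigma> = "hard_input n m i"
  \<comment> \<open>Block \<open>j\<close> goes to agent \<open>j\<close>, and the common block goes
    to \<open>i\<close>, whose own block is worthless.\<close>
  define A where "A l = {k. k < m * Suc n \<and> (if k div m = 0 then i else k div m) = l}" for l
  have "k div m \<le> n" if "k < m * Suc n" for k
    using that assms(1) by (metis less_Suc_eq_le less_mult_imp_div_less mult.commute)
  then have "(if k div m = 0 then i else k div m) \<in> {1..n}" if "k < m * Suc n" for k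
    using that assms(2) by (auto simp: Suc_le_eq)
  then have "is_allocation n ?\<sigma> A"
    unfolding is_allocation_def length_hard_input A_def disjoint_family_on_def by blast
  moreover have "real m \<le> valuation ?\<sigma> l (A l)" if l: "l \<in> {1..n}" for l
  proof -
    \<comment> \<open>The block that alone is worth \<open>m\<close> to agent \<open>l\<close>: the
      common block for \<open>i\<close>, the own block for everyone else.\<close>
    let ?j = "if l = i then 0 else l"
    have "{k. k div m = ?j} \<subseteq> A l"
    proof
      fix k assume "k \<in> {k. k div m = ?j}"
      then have k: "k div m = ?j" by simp
      then have "k div m < Suc n" using l by (auto simp: less_Suc_eq_le)
      then have "k < m * Suc n"
        using assms(1) by (metis div_less_iff_less_mult mult.commute)
      with k l show "k \<in> A l" by (auto simp: A_def)
    qed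
    have fin: "finite (A l)" by (simp add: A_def)
    have "real m = (\<Sum>k\<in>{k. k div m = ?j}. 1)"
      by (simp only: sum_constant card_block[OF assms(1)] mult_1_right)
    also have "\<dots> = (\<Sum>k\<in>{k. k div m = ?j}. (?\<sigma> ! k) l)"
    proof (rule sum.cong)
      fix k assume k: "k \<in> {k. k div m = ?j}"
      with \<open>{k. k div m = ?j} \<subseteq> A l\<close> have "k < m * Suc n" by (auto simp: A_def)
      with k l assms(1) show "1 = (?\<sigma> ! k) l"
        by (auto simp: nth_hard_input div_eq_0_iff split: if_splits)
    qed simp
    also have "\<dots> \<le> (\<Sum>k\<in>A l. (?\<sigma> ! k) l)"
      using \<open>{k. k div m = ?j} \<subseteq> A l\<close> fin l
      by (intro sum_mono2) (auto simp: A_def nth_hard_input simp del: mult_Suc_right)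
    finally show ?thesis
      by (simp add: valuation_def)
  qed
  then have "real m \<le> min_value n ?\<sigma> A"
    unfolding min_value_def using assms(2) by (intro Min.boundedI) auto
  ultimately show ?thesis
    using min_value_le_OPT order_trans by blast
qed

text \<open>The minimum is at most the value of agent \<open>i\<close>, who values only the common
  items, and those are handed out exactly as if the input ended with them.\<close>

lemma ALG_hard_input_le_share:
  assumes i: "i \<in> {1..n}"
  shows "ALG n alg (hard_input n m i) \<omega> \<le> share alg (common_items n m) i \<omega>"
proof -
  let ?\<sigma> = "hard_input n m i"
  let ?A = "online_allocation alg \<omega> ?\<sigma> i"
  have A: "k < m * Suc n" if "k \<in> ?A" for k
    using that by (auto simp: online_allocation_def length_hard_input)
  have "?A \<inter> {..<m} = {k. k < m \<and> decisions alg \<omega> (common_items n m) m ! k = i}"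
    using nth_decisions_prefix[of _ m "m * Suc n" alg \<omega> ?\<sigma>]
    by (auto simp: online_allocation_def length_hard_input take_hard_input)
  then have share: "share alg (common_items n m) i \<omega> = real (card (?A \<inter> {..<m}))"
    by (simp add: share_def common_items_def)
  have "ALG n alg ?\<sigma> \<omega> \<le> valuation ?\<sigma> i ?A"
    unfolding ALG_def min_value_def using i by (intro Min_le) auto
  also have "\<dots> = (\<Sum>k\<in>?A. if k \<in> {..<m} then 1 else 0)"
    unfolding valuation_def using A i by (intro sum.cong) (auto simp: nth_hard_input simp del: mult_Suc_right)
  also have "\<dots> = share alg (common_items n m) i \<omega>"
    by (subst sum.inter_restrict[symmetric]) (auto simp: online_allocation_def share)
  finally show ?thesis .
qed

section \<open>The bound on the ratio\<close>

lemma inf_ratio_le: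
  assumes n: "n \<ge> 1" and alg: "randomized_online_algorithm n M alg"
  shows "inf_ratio n M alg K \<le> ereal (1 / real n)"
proof -
  \<comment> \<open>Rounding up reaches the threshold \<open>K\<close>; the maximum with 1 keeps the
    blocks nonempty and \<open>OPT\<close> positive even when \<open>K\<close> is not.\<close>
  define m where "m = nat \<lceil>max K 1\<rceil>"
  have m: "m > 0" "K \<le> real m"
    unfolding m_def by linarith+
  obtain i where i: "i \<in> {1..n}"
    and small: "integral\<^sup>L M (share alg (common_items n m) i) \<le> real m / real n"
    using exists_small_expected_share[OF n alg common_items_in_lists[of n m]]
    by (auto simp: common_items_def)
  let ?\<sigma> = "hard_input n m i"
  note OPT = OPT_hard_input[OF m(1) i]
  \<comment> \<open>It suffices that the larger function, the share, is integrable and nonnegative,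
    because a non-integrable function has integral 0 by default.\<close>
  have "integral\<^sup>L M (ALG n alg ?\<sigma>) \<le> integral\<^sup>L M (share alg (common_items n m) i)"
    by (intro integral_mono' integrable_share[OF alg common_items_in_lists]
        ALG_hard_input_le_share[OF i]) (simp add: share_def)
  also note small
  also have "real m / real n \<le> OPT n ?\<sigma> / real n"
    using OPT by (intro divide_right_mono) auto
  finally have "integral\<^sup>L M (ALG n alg ?\<sigma>) / OPT n ?\<sigma> \<le> 1 / real n"
    using OPT m(1) n by (simp add: field_simps)
  moreover have "?\<sigma> \<in> {\<sigma> \<in> lists (items n). OPT n \<sigma> \<ge> K}"
    using hard_input_in_lists OPT m(2) by (auto simp del: in_lists_conv_set)
  ultimately show ?thesis
    unfolding inf_ratio_def by (intro INF_lower2) auto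
qed

theorem theorem5:
  fixes n :: nat and M :: "'r measure" and alg :: "'r online_alg"
  assumes "n \<ge> 1"
    and "randomized_online_algorithm n M alg"
  shows "asymptotic_competitive_ratio n M alg \<le> ereal (1 / real n)"
proof (rule tendsto_upperbound)
  show "(inf_ratio n M alg \<longlongrightarrow> asymptotic_competitive_ratio n M alg) at_top"
    by (rule tendsto_asymptotic_competitive_ratio)
  show "\<forall>\<^sub>F K in at_top. inf_ratio n M alg K \<le> ereal (1 / real n)"
    using inf_ratio_le[OF assms] by (intro always_eventually allI)
qed simp

end
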